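(* Let $G$ be a digraph and $\bar G$ the transitive closure of $G$. Let $\bar f$ be a discrete Morse function on $\bar G$ which is the extension of a discrete Morse function $f$ on $G$, with discrete gradient vector field $\overline{V}$ and discrete gradient flow $\overline{\Phi}$ on $\bar G$. Suppose that $\Omega_*(G)$ is $\overline{V}$-invariant, i.e. $\overline{V}(\Omega_n(G))\subseteq\Omega_{n+1}(G)$ for all $n\ge0$, and that $\overline{\Phi}(\alpha)\in\Omega_*(G)$ for any $\alpha\in\mathrm{Crit}_*(\bar G)\cap P_*(G)$. Put $$b_m=\dim H_m(G;\mathbb{R}),\qquad l_m=\dim\big(\mathrm{Crit}_m(\bar G)\cap P_m(G)\big),\qquad L_m=\dim\mathrm{Crit}_m(G).$$ Then for every $m\ge0$, $$L_m\ge l_m,\qquad l_m-l_{m-1}+\cdots+(-1)^m l_0\ \ge\ b_m-b_{m-1}+\cdots+(-1)^m b_0,$$ and $$l_0-l_1+\cdots+(-1)^{\dim G}l_{\dim G}\ \ge\ b_0-b_1+\cdots+(-1)^{\dim G}b_{\dim G},$$ where $\dim G=\max\{p\mid\Omega_p(G)\ne0\}$.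
   Context: A digraph $G$ consists of a finite vertex set $V$ and a non-empty edge set $E\subseteq V\times V\setminus\mathrm{diag}$; $(u,v)\in E$ is written $u\to v$. A digraph is transitive if for any two edges $u\to v$ and $v\to w$ there is an edge $u\to w$. The transitive closure $\bar G$ of $G$ is the smallest transitive digraph containing $G$; it has the same vertex set as $G$, and $\bar f$ is the extension of $f$ means $\bar f(v)=f(v)$ for all vertices $v$. $\Lambda_n(V)$ is the real vector space with basis all sequences $v_0\cdots v_n$ of vertices (elementary $n$-paths), with inner product $\langle\cdot,\cdot\rangle$ making elementary paths orthonormal. $\partial=\partial_n:\Lambda_n(V)\to\Lambda_{n-1}(V)$ is $\partial(v_0\cdots v_n)=\sum_{i=0}^n(-1)^i v_0\cdots\widehat{v_i}\cdots v_n$ (with $\partial_0=0$). For a digraph $G$, an allowed elementary $n$-path on $G$ is $v_0\cdots v_n$ with $v_{i-1}\to v_i$ an edge for $1\le i\le n$; $P_n(G)$ is their span, $\Omega_n(G)=\{x\in P_n(G):\partial x\in P_{n-1}(G)\}$, and the path homology is $H_m(G;\mathbb{R})=H_m(\{\Omega_n(G),\partial_n\}_{n\ge0})$. For allowed elementary paths, $\alpha>\beta$ (or $\beta<\alpha$) means $\beta$ is obtained from $\alpha$ by removing some vertices; a superscript $(n)$ indicates an $n$-path. For $f:V\to[0,+\infty)$ put $f(v_0\cdots v_n)=\sum_i f(v_i)$. $f$ is a discrete Morse function on a digraph if for every allowed elementary $\alpha^{(n)}$ on it, $\#\{\gamma^{(n+1)}>\alpha \mid f(\gamma)=f(\alpha)\}\le1$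 and $\#\{\beta^{(n-1)}<\alpha \mid f(\beta)=f(\alpha)\}\le1$, with $\gamma,\beta$ allowed elementary paths on that digraph; $\alpha^{(n)}$ is critical if both numbers are $0$. $\mathrm{Crit}_n(G)$ is the span of all critical $n$-paths of $f$ on $G$, and $\mathrm{Crit}_n(\bar G)$ is the span of all critical $n$-paths of $\bar f$ on $\bar G$. $\overline{V}=\mathrm{grad}\bar f:P_n(\bar G)\to P_{n+1}(\bar G)$ is the linear map with $\overline{V}(\alpha)=-\langle\partial\gamma,\alpha\rangle\gamma$ if there is an allowed elementary $\gamma^{(n+1)}>\alpha^{(n)}$ on $\bar G$ with $\bar f(\gamma)=\bar f(\alpha)$, and $\overline{V}(\alpha)=0$ otherwise. The discrete gradient flow is $\overline{\Phi}=\mathrm{Id}+\partial\overline{V}+\overline{V}\partial$ on $P_*(\bar G)$. *)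

theory Defs
  imports "HOL-Analysis.Analysis" "HOL-Analysis.Finite_Function_Topology" "HOL-Library.Sublist" "HOL-Library.Set_Algebras"
    "Graph_Theory.Pair_Digraph"
begin

section \<open>Digraphs and transitive closure\<close>

text \<open>The locale \<^term>\<open>pair_digraph\<close> provides a finite vertex set and loop-free arcs between
  vertices.\<close>

definition is_digraph :: "'v pair_pre_digraph \<Rightarrow> bool" where
  "is_digraph G \<longleftrightarrow> pair_digraph G \<and> parcs G \<noteq> {}"

definition contained_in :: "'v pair_pre_digraph \<Rightarrow> 'v pair_pre_digraph \<Rightarrow> bool" where
  "contained_in G K \<longleftrightarrow> pverts G \<subseteq> pverts K \<and> parcs G \<subseteq> parcs K"

definition transitive_digraph :: "'v pair_pre_digraph \<Rightarrow> bool" where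
  "transitive_digraph G \<longleftrightarrow> is_digraph G \<and> trans (parcs G)"

text \<open>Since digraphs have no loops, a digraph with a directed cycle is not contained in any
  transitive digraph. Transitive closures are therefore described by a relation: \<open>H\<close> is the
  transitive closure of \<open>G\<close>.\<close>

definition is_transitive_closure :: "'v pair_pre_digraph \<Rightarrow> 'v pair_pre_digraph \<Rightarrow> bool" where
  "is_transitive_closure H G \<longleftrightarrow>
     transitive_digraph H \<and> contained_in G H \<and>
     (\<forall>K. transitive_digraph K \<and> contained_in G K \<longrightarrow> contained_in H K)"

section \<open>Chains of elementary paths\<close>

text \<open>An elementary \<open>n\<close>-path is a list of length \<open>n + 1\<close>; \<open>\<Lambda>\<^sub>n(V)\<close> is the span of these inside
  the real vector space of finitely supported functions on lists. The maps below act on all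
  degrees at once.\<close>

type_synonym 'v chain = "'v list \<Rightarrow>\<^sub>0 real"

definition elem :: "'v list \<Rightarrow> 'v chain" where
  "elem p = Poly_Mapping.single p 1"

definition chain_inner :: "'v chain \<Rightarrow> 'v chain \<Rightarrow> real" where
  "chain_inner x y =
     (\<Sum>p \<in> Poly_Mapping.keys x. Poly_Mapping.lookup x p * Poly_Mapping.lookup y p)"

definition linear_extension :: "('v list \<Rightarrow> 'v chain) \<Rightarrow> 'v chain \<Rightarrow> 'v chain" where
  "linear_extension g x = (\<Sum>p \<in> Poly_Mapping.keys x. Poly_Mapping.lookup x p *\<^sub>R g p)"

text \<open>The first case of the conditional is the convention that the boundary of a \<open>0\<close>-path
  vanishes.\<close>

definition boundary :: "'v chain \<Rightarrow> 'v chain" where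
  "boundary = linear_extension (\<lambda>p.
     if length p \<le> 1 then 0
     else (\<Sum>i<length p. (-1) ^ i *\<^sub>R elem (take i p @ drop (Suc i) p)))"

definition allowed :: "'v pair_pre_digraph \<Rightarrow> 'v list \<Rightarrow> bool" where
  "allowed G p \<longleftrightarrow>
     p \<noteq> [] \<and> set p \<subseteq> pverts G \<and> successively (\<lambda>u v. (u, v) \<in> parcs G) p"

definition P :: "'v pair_pre_digraph \<Rightarrow> nat \<Rightarrow> 'v chain set" where
  "P G n = span {elem p | p. allowed G p \<and> length p = n + 1}"

definition Omega :: "'v pair_pre_digraph \<Rightarrow> nat \<Rightarrow> 'v chain set" where
  "Omega G n = {x \<in> P G n. n > 0 \<longrightarrow> boundary x \<in> P G (n - 1)}"

definition digraph_dim :: "'v pair_pre_digraph \<Rightarrow> nat" where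
  "digraph_dim G = Max {p. Omega G p \<noteq> {0}}"

section \<open>Path homology\<close>

text \<open>The quotient \<open>Z / B\<close> of a subspace \<open>Z\<close> by a subspace \<open>B \<subseteq> Z\<close> is the set of cosets. In
  \<open>quot_lincomb\<close>, which is the linear combination of the cosets in \<open>T\<close> with coefficients \<open>c\<close>, the
  summand \<open>B\<close> is the zero of the quotient; it makes the formula correct also for empty \<open>T\<close> and
  for zero coefficients, where the image of a coset is only \<open>{0}\<close>.\<close>

definition quot_space :: "'b::real_vector set \<Rightarrow> 'b set \<Rightarrow> 'b set set" where
  "quot_space Z B = (\<lambda>z. z +o B) ` Z"

definition quot_lincomb :: "'b::real_vector set \<Rightarrow> 'b set set \<Rightarrow> ('b set \<Rightarrow> real) \<Rightarrow> 'b set" where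
  "quot_lincomb B T c = B + (\<Sum>X\<in>T. (\<lambda>x. c X *\<^sub>R x) ` X)"

definition quot_basis :: "'b::real_vector set \<Rightarrow> 'b set \<Rightarrow> 'b set set \<Rightarrow> bool" where
  "quot_basis Z B S \<longleftrightarrow> S \<subseteq> quot_space Z B \<and>
     (\<forall>T c. finite T \<and> T \<subseteq> S \<and> quot_lincomb B T c = B \<longrightarrow> (\<forall>X\<in>T. c X = 0)) \<and>
     (\<forall>Y \<in> quot_space Z B. \<exists>T c. finite T \<and> T \<subseteq> S \<and> quot_lincomb B T c = Y)"

definition quot_dim :: "'b::real_vector set \<Rightarrow> 'b set \<Rightarrow> nat" where
  "quot_dim Z B = card (SOME S. quot_basis Z B S)"

definition betti :: "'v pair_pre_digraph \<Rightarrow> nat \<Rightarrow> nat" where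
  "betti G m = quot_dim {x \<in> Omega G m. boundary x = 0} (boundary ` Omega G (m + 1))"

section \<open>Discrete Morse functions, gradient and flow\<close>

definition path_value :: "('v \<Rightarrow> real) \<Rightarrow> 'v list \<Rightarrow> real" where
  "path_value f p = (\<Sum>v\<leftarrow>p. f v)"

definition level_cofaces :: "'v pair_pre_digraph \<Rightarrow> ('v \<Rightarrow> real) \<Rightarrow> 'v list \<Rightarrow> 'v list set" where
  "level_cofaces G f p =
     {q. allowed G q \<and> length q = length p + 1 \<and> strict_subseq p q \<and> path_value f q = path_value f p}"

definition level_faces :: "'v pair_pre_digraph \<Rightarrow> ('v \<Rightarrow> real) \<Rightarrow> 'v list \<Rightarrow> 'v list set" where
  "level_faces G f p =
     {q. allowed G q \<and> length p = length q + 1 \<and> strict_subseq q p \<and> path_value f q = path_value f p}"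

definition discrete_morse :: "'v pair_pre_digraph \<Rightarrow> ('v \<Rightarrow> real) \<Rightarrow> bool" where
  "discrete_morse G f \<longleftrightarrow>
     (\<forall>v\<in>pverts G. f v \<ge> 0) \<and>
     (\<forall>p. allowed G p \<longrightarrow> card (level_cofaces G f p) \<le> 1 \<and> card (level_faces G f p) \<le> 1)"

definition critical :: "'v pair_pre_digraph \<Rightarrow> ('v \<Rightarrow> real) \<Rightarrow> 'v list \<Rightarrow> bool" where
  "critical G f p \<longleftrightarrow>
     allowed G p \<and> card (level_cofaces G f p) = 0 \<and> card (level_faces G f p) = 0"

definition Crit :: "'v pair_pre_digraph \<Rightarrow> ('v \<Rightarrow> real) \<Rightarrow> nat \<Rightarrow> 'v chain set" where
  "Crit G f n = span {elem p | p. critical G f p \<and> length p = n + 1}"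

text \<open>The gradient is a map on \<open>P\<^sub>*(G)\<close>; it is set to \<open>0\<close> on elementary paths that are not
  allowed. For a discrete Morse function the set of level cofaces has at most one element.\<close>

definition grad :: "'v pair_pre_digraph \<Rightarrow> ('v \<Rightarrow> real) \<Rightarrow> 'v chain \<Rightarrow> 'v chain" where
  "grad G f = linear_extension (\<lambda>p.
     if allowed G p \<and> level_cofaces G f p \<noteq> {} then
       (let q = (THE q. q \<in> level_cofaces G f p)
        in - chain_inner (boundary (elem q)) (elem p) *\<^sub>R elem q)
     else 0)"

definition flow :: "'v pair_pre_digraph \<Rightarrow> ('v \<Rightarrow> real) \<Rightarrow> 'v chain \<Rightarrow> 'v chain" where
  "flow G f x = x + boundary (grad G f x) + grad G f (boundary x)"

end

theory Submission
  imports Defs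
begin

text \<open>
  A loop-free transitive digraph \<open>H\<close> is acyclic, so its allowed paths have distinct vertices and all
  faces of an allowed path are allowed. The Morse condition then says that an allowed path of \<open>H\<close>
  has at most one vertex of value \<open>0\<close>, and the level pairs are the pairs (path without its zero
  vertex, path). This gives \<open>V V = 0\<close> and \<open>V \<partial> V = - V\<close>, so \<open>\<Phi> = 1 + \<partial> V + V \<partial>\<close> is already
  idempotent: no iteration of the flow is needed. Since \<open>\<Phi>\<close> is chain homotopic to the identity on
  \<open>\<Omega>\<^sub>*(G)\<close>, the complex \<open>\<Phi>(\<Omega>\<^sub>*(G))\<close> computes the path homology of \<open>G\<close>, and \<open>\<Phi>\<close> maps
  \<open>Crit\<^sub>n(H) \<inter> P\<^sub>n(G)\<close> isomorphically onto \<open>\<Phi>(\<Omega>\<^sub>n(G))\<close>. The inequalities are the algebraic Morse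
  inequalities of this complex.
\<close>

section \<open>Linear algebra in finite dimension\<close>

text \<open>The right-hand side is independence of \<open>A\<close> modulo \<open>span B\<close>,
  the form in which bases of kernels and quotients are compared with bases of the whole
  space.\<close>

lemma independent_Un_iff:
  fixes A B :: "'a::real_vector set"
  assumes "independent B" "A \<inter> B = {}"
  shows "independent (A \<union> B) \<longleftrightarrow>
    (\<forall>T c. finite T \<and> T \<subseteq> A \<and> (\<Sum>x\<in>T. c x *\<^sub>R x) \<in> span B \<longrightarrow> (\<forall>x\<in>T. c x = 0))"
proof (intro iffI allI impI)
  fix T and c :: "'a \<Rightarrow> real"
  assume ind: "independent (A \<union> B)"
    and T: "finite T \<and> T \<subseteq> A \<and> (\<Sum>x\<in>T. c x *\<^sub>R x) \<in> span B"
  then obtain t r where t: "finite t" "t \<subseteq> B" "(\<Sum>x\<in>T. c x *\<^sub>R x) = (\<Sum>x\<in>t. r x *\<^sub>R x)"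
    unfolding span_explicit by auto
  have disj: "T \<inter> t = {}" using assms(2) T t(2) by blast
  define u where "u x = (if x \<in> T then c x else - r x)" for x
  have 1: "(\<Sum>x\<in>T. u x *\<^sub>R x) = (\<Sum>x\<in>T. c x *\<^sub>R x)"
    by (rule sum.cong) (auto simp: u_def)
  have 2: "(\<Sum>x\<in>t. u x *\<^sub>R x) = - (\<Sum>x\<in>t. r x *\<^sub>R x)"
    unfolding sum_negf[symmetric] using disj by (intro sum.cong) (auto simp: u_def)
  have "(\<Sum>x\<in>T \<union> t. u x *\<^sub>R x) = 0"
    using T t disj by (subst sum.union_disjoint) (auto simp: 1 2)
  then have "u x = 0" if "x \<in> T \<union> t" for x
    using independentD[OF ind, of "T \<union> t" u x] T t(1,2) that by blast
  then have "\<forall>x\<in>T. u x = 0" by blast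
  then show "\<forall>x\<in>T. c x = 0" by (simp add: u_def)
next
  assume H: "\<forall>T c. finite T \<and> T \<subseteq> A \<and> (\<Sum>x\<in>T. c x *\<^sub>R x) \<in> span B \<longrightarrow> (\<forall>x\<in>T. c x = 0)"
  show "independent (A \<union> B)"
    unfolding independent_explicit_module
  proof (intro allI impI)
    fix t u v assume t: "finite t" "t \<subseteq> A \<union> B" "(\<Sum>v\<in>t. u v *\<^sub>R v) = 0" "v \<in> t"
    have "t = (t \<inter> A) \<union> (t \<inter> B)" using t(2) by blast
    then have eq: "(\<Sum>v\<in>t \<inter> A. u v *\<^sub>R v) + (\<Sum>v\<in>t \<inter> B. u v *\<^sub>R v) = 0"
      using t assms(2) sum.union_disjoint[of "t \<inter> A" "t \<inter> B" "\<lambda>v. u v *\<^sub>R v"] by auto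
    have inB: "(\<Sum>v\<in>t \<inter> B. u v *\<^sub>R v) \<in> span B"
      by (intro span_sum span_scale span_base) auto
    have "(\<Sum>v\<in>t \<inter> A. u v *\<^sub>R v) \<in> span B"
      using eq inB by (metis add_eq_0_iff2 span_neg)
    then have zA: "\<forall>v\<in>t \<inter> A. u v = 0"
      using H[rule_format, of "t \<inter> A" u] t(1) by simp
    then have "(\<Sum>v\<in>t \<inter> B. u v *\<^sub>R v) = 0" using eq by simp
    then have "\<forall>v\<in>t \<inter> B. u v = 0"
      using independentD[OF assms(1), of "t \<inter> B" u] t(1) by simp
    then show "u v = 0" using zA t by blast
  qed
qed

text \<open>The chain space has infinite dimension, and \<open>dim\<close> is a cardinality that is
  0 for an infinite basis; the finite set \<open>F\<close> excludes this.\<close>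

lemma dim_mono_finite:
  fixes S T :: "'a::real_vector set"
  assumes "S \<subseteq> T" "T \<subseteq> span F" "finite F"
  shows "dim S \<le> dim T"
proof -
  obtain B where B: "B \<subseteq> S" "independent B" "S \<subseteq> span B" "card B = dim S"
    using basis_exists by blast
  obtain C where C: "C \<subseteq> T" "independent C" "T \<subseteq> span C" "card C = dim T"
    using basis_exists by blast
  have "finite C" using independent_span_bound[OF assms(3) C(2)] C(1) assms(2) by blast
  then show ?thesis using independent_span_bound[of C B] B C assms(1) by auto
qed

lemma subspace_kernel_on:
  fixes f :: "'a::real_vector \<Rightarrow> 'b::real_vector"
  assumes "linear f" "subspace U"
  shows "subspace {x \<in> U. f x = 0}"
  using assms(2)
  by (auto simp: subspace_def linear_0[OF assms(1)] linear_add[OF assms(1)] linear_scale[OF assms(1)])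

text \<open>A basis \<open>B\<close> of the kernel is extended to a basis \<open>C\<close> of
  \<open>U\<close>; then \<open>f\<close> maps \<open>C - B\<close> bijectively onto a basis of the
  image.\<close>

lemma dim_kernel_plus_image:
  fixes f :: "'a::real_vector \<Rightarrow> 'b::real_vector"
  assumes f: "linear f" and U: "subspace U" "U \<subseteq> span F" "finite F"
  shows "dim U = dim {x \<in> U. f x = 0} + dim (f ` U)"
proof -
  let ?K = "{x \<in> U. f x = 0}"
  have K: "subspace ?K" using subspace_kernel_on[OF f U(1)] .
  obtain B where B: "B \<subseteq> ?K" "independent B" "?K \<subseteq> span B" "card B = dim ?K"
    using basis_exists by blast
  have KB: "?K = span B" using B(1,3) K span_minimal by blast
  obtain C where C: "B \<subseteq> C" "C \<subseteq> U" "independent C" "U \<subseteq> span C"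
    using maximal_independent_subset_extend[of B U] B by blast
  have fin: "finite C" using independent_span_bound[OF U(3) C(3)] C(2) U(2) by blast
  \<comment> \<open>This yields both injectivity of \<open>f\<close> on \<open>C - B\<close> and
    independence of the images: a vanishing combination of images comes from an element of
    \<open>span B\<close>.\<close>
  have zero: "\<forall>x\<in>T. c x = 0" if "finite T" "T \<subseteq> C - B" "(\<Sum>x\<in>T. c x *\<^sub>R f x) = 0" for T c
  proof -
    have "(\<Sum>x\<in>T. c x *\<^sub>R x) \<in> U"
      using that C(2) by (intro subspace_sum subspace_scale U(1)) auto
    moreover have "f (\<Sum>x\<in>T. c x *\<^sub>R x) = 0"
      using that by (simp add: linear_sum[OF f] linear_scale[OF f])
    ultimately have "(\<Sum>x\<in>T. c x *\<^sub>R x) \<in> span B" using KB by blast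
    moreover have "independent ((C - B) \<union> B)" using C(1,3) by (simp add: Un_absorb2)
    ultimately show ?thesis
      using independent_Un_iff[OF B(2), of "C - B"] that by blast
  qed
  have inj: "inj_on f (C - B)"
  proof (rule inj_onI, rule ccontr)
    fix x y assume xy: "x \<in> C - B" "y \<in> C - B" "f x = f y" "x \<noteq> y"
    show False
      using zero[of "{x, y}" "\<lambda>z. if z = x then 1 else -1"] xy by auto
  qed
  have "independent (f ` (C - B))"
    unfolding independent_explicit_module
  proof (intro allI impI)
    fix t u v assume t: "finite t" "t \<subseteq> f ` (C - B)" "(\<Sum>v\<in>t. u v *\<^sub>R v) = 0" "v \<in> t"
    obtain T where T: "T \<subseteq> C - B" "t = f ` T" using t(2) by (meson subset_imageE)
    have injT: "inj_on f T" using inj T inj_on_subset by blast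
    have "finite T" using t(1) T injT finite_image_iff by blast
    moreover have "(\<Sum>x\<in>T. u (f x) *\<^sub>R f x) = 0"
      using t(3) T(2) injT by (simp add: sum.reindex)
    ultimately show "u v = 0" using zero[of T "u \<circ> f"] T t(4) by auto
  qed
  moreover have "f ` U \<subseteq> span (f ` (C - B))"
  proof -
    have "f ` U \<subseteq> span (f ` C)" using C(4) linear_span_image[OF f, of C] by blast
    also have "\<dots> \<subseteq> span (f ` (C - B))"
    proof (rule span_minimal)
      show "f ` C \<subseteq> span (f ` (C - B))"
      proof
        fix y assume "y \<in> f ` C"
        then obtain x where x: "x \<in> C" "y = f x" by blast
        show "y \<in> span (f ` (C - B))"
        proof (cases "x \<in> B")
          case True
          then have "f x = 0" using B(1) by blast
          then show ?thesis using x by (simp add: span_zero)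
        next
          case False
          then show ?thesis using x by (auto intro: span_base)
        qed
      qed
    qed simp
    finally show ?thesis .
  qed
  moreover have "f ` (C - B) \<subseteq> f ` U" using C(2) by blast
  ultimately have "dim (f ` U) = card (f ` (C - B))" by (intro dim_unique) auto
  also have "\<dots> = card C - card B"
    using inj C(1) fin by (simp add: card_image card_Diff_subset finite_subset)
  finally have "dim (f ` U) = card C - card B" .
  moreover have "dim U = card C" using C by (intro dim_unique) auto
  ultimately show ?thesis using B(4) card_mono[OF fin C(1)] by simp
qed

section \<open>Quotient spaces and their dimension\<close>

lemma quot_lincomb_eq:
  fixes B :: "'a::real_vector set"
  assumes B: "subspace B" and "finite T" and r: "\<And>X. X \<in> T \<Longrightarrow> X = r X +o B"
  shows "quot_lincomb B T c = (\<Sum>X\<in>T. c X *\<^sub>R r X) +o B"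
  using assms(2,3)
proof (induction T rule: finite_induct)
  case empty
  then show ?case by (simp add: quot_lincomb_def)
next
  case (insert X T)
  have "quot_lincomb B (insert X T) c = (\<lambda>x. c X *\<^sub>R x) ` X + quot_lincomb B T c"
    using insert.hyps by (simp add: quot_lincomb_def ac_simps)
  also have "quot_lincomb B T c = (\<Sum>X\<in>T. c X *\<^sub>R r X) +o B"
    using insert by auto
  also have "(\<lambda>x. c X *\<^sub>R x) ` X + \<dots> = (c X *\<^sub>R r X + (\<Sum>X\<in>T. c X *\<^sub>R r X)) +o B"
    (is "?L = ?R")
  proof (intro subset_antisym subsetI)
    fix y assume "y \<in> ?L"
    then obtain x b where xb: "x \<in> X" "b \<in> B" "y = c X *\<^sub>R x + ((\<Sum>X\<in>T. c X *\<^sub>R r X) + b)"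
      by (auto elim!: set_plus_elim simp: elt_set_plus_def)
    obtain b' where "b' \<in> B" "x = r X + b'"
      using xb(1) insert.prems[of X] by (auto simp: elt_set_plus_def)
    then show "y \<in> ?R"
      using xb subspace_add[OF B subspace_scale[OF B, of b' "c X"], of b]
      by (auto simp: elt_set_plus_def algebra_simps intro!: bexI[of _ "c X *\<^sub>R b' + b"])
  next
    \<comment> \<open>All of \<open>b\<close> is left to the second summand, so no division by
      \<open>c X\<close> occurs and the value 0 is covered.\<close>
    fix y assume "y \<in> ?R"
    then obtain b where b: "b \<in> B" "y = c X *\<^sub>R r X + ((\<Sum>X\<in>T. c X *\<^sub>R r X) + b)"
      by (auto simp: elt_set_plus_def add.assoc)
    have "r X \<in> X"
      using insert.prems[of X] subspace_0[OF B] by (auto simp: elt_set_plus_def)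
    then show "y \<in> ?L"
      unfolding b(2) using b(1) by (intro set_plus_intro) (auto simp: elt_set_plus_def)
  qed
  finally show ?case using insert.hyps by simp
qed

lemma coset_eq_iff:
  fixes B :: "'a::real_vector set"
  assumes "subspace B"
  shows "x +o B = y +o B \<longleftrightarrow> x - y \<in> B"
proof
  assume "x +o B = y +o B"
  moreover have "x \<in> x +o B"
    using subspace_0[OF assms] by (auto simp: elt_set_plus_def)
  ultimately show "x - y \<in> B" by (auto simp: elt_set_plus_def)
next
  assume d: "x - y \<in> B"
  show "x +o B = y +o B"
  proof (intro subset_antisym subsetI)
    fix z assume "z \<in> x +o B"
    then obtain b where "b \<in> B" "z = x + b" by (auto simp: elt_set_plus_def)
    then show "z \<in> y +o B"
      using subspace_add[OF assms d, of b]
      by (auto simp: elt_set_plus_def intro!: bexI[of _ "x - y + b"])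
  next
    fix z assume "z \<in> y +o B"
    then obtain b where "b \<in> B" "z = y + b" by (auto simp: elt_set_plus_def)
    then show "z \<in> x +o B"
      using subspace_diff[OF assms _ d, of b]
      by (auto simp: elt_set_plus_def intro!: bexI[of _ "b - (x - y)"])
  qed
qed

text \<open>Representatives \<open>r X\<close> of the basis cosets together with a basis
  \<open>b\<close> of \<open>B\<close> form a basis of \<open>Z\<close>.\<close>

lemma card_quot_basis:
  fixes B Z :: "'a::real_vector set"
  assumes B: "subspace B" "B \<subseteq> Z" and Z: "subspace Z" "Z \<subseteq> span F" "finite F"
    and S: "quot_basis Z B S"
  shows "card S + dim B = dim Z"
proof -
  have "S \<subseteq> quot_space Z B" using S by (simp add: quot_basis_def)
  then have "\<forall>X\<in>S. \<exists>z\<in>Z. X = z +o B" by (auto simp: quot_space_def)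
  then obtain r where "\<forall>X\<in>S. r X \<in> Z \<and> X = r X +o B"
    using bchoice[of S "\<lambda>X z. z \<in> Z \<and> X = z +o B"] by blast
  then have r: "\<And>X. X \<in> S \<Longrightarrow> r X \<in> Z" "\<And>X. X \<in> S \<Longrightarrow> X = r X +o B" by blast+
  have injr: "inj_on r S"
  proof (rule inj_onI)
    fix X Y assume XY: "X \<in> S" "Y \<in> S" "r X = r Y"
    have "X = r X +o B" using r(2) XY(1) .
    also have "\<dots> = Y" using r(2)[OF XY(2)] XY(3) by simp
    finally show "X = Y" .
  qed
  have ind: "\<forall>X\<in>T. c X = 0" if "finite T" "T \<subseteq> S" "(\<Sum>X\<in>T. c X *\<^sub>R r X) \<in> B" for T c
  proof -
    have "quot_lincomb B T c = (\<Sum>X\<in>T. c X *\<^sub>R r X) +o B"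
      using that(2) by (intro quot_lincomb_eq[OF B(1) that(1)]) (rule r(2), blast)
    also have "\<dots> = B" using coset_eq_iff[OF B(1), of _ 0] that(3) by simp
    finally show ?thesis using S that(1,2) unfolding quot_basis_def by simp
  qed
  have gen: "\<exists>T c. finite T \<and> T \<subseteq> S \<and> z - (\<Sum>X\<in>T. c X *\<^sub>R r X) \<in> B" if "z \<in> Z" for z
  proof -
    have "z +o B \<in> quot_space Z B" using that by (simp add: quot_space_def)
    then obtain T c where T: "finite T" "T \<subseteq> S" "quot_lincomb B T c = z +o B"
      using S unfolding quot_basis_def by auto
    have "quot_lincomb B T c = (\<Sum>X\<in>T. c X *\<^sub>R r X) +o B"
      using T(2) by (intro quot_lincomb_eq[OF B(1) T(1)]) (rule r(2), blast)
    then have "z - (\<Sum>X\<in>T. c X *\<^sub>R r X) \<in> B" using T(3) coset_eq_iff[OF B(1), of z] by simp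
    then show ?thesis using T by blast
  qed
  obtain b where b: "b \<subseteq> B" "independent b" "B \<subseteq> span b" "card b = dim B"
    using basis_exists by blast
  have spb: "span b = B" using b(1,3) B(1) span_minimal by blast
  \<comment> \<open>A representative in \<open>B\<close> would by itself be a relation with
    coefficient 1, against \<open>ind\<close>.\<close>
  have disj: "r ` S \<inter> b = {}"
  proof -
    have "r X \<notin> B" if "X \<in> S" for X using ind[of "{X}" "\<lambda>_. 1"] that by auto
    then show ?thesis using b(1) by blast
  qed
  have indrb: "independent (r ` S \<union> b)"
    unfolding independent_Un_iff[OF b(2) disj]
  proof (intro allI impI)
    fix t u assume t: "finite t \<and> t \<subseteq> r ` S \<and> (\<Sum>x\<in>t. u x *\<^sub>R x) \<in> span b"
    obtain T where T: "T \<subseteq> S" "t = r ` T" using t by (meson subset_imageE)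
    have injT: "inj_on r T" using injr T inj_on_subset by blast
    have "finite T" using t T injT finite_image_iff by blast
    moreover have "(\<Sum>X\<in>T. u (r X) *\<^sub>R r X) \<in> B"
      using t T(2) injT spb by (simp add: sum.reindex)
    ultimately show "\<forall>x\<in>t. u x = 0" using ind[of T "u \<circ> r"] T by auto
  qed
  have sub: "r ` S \<union> b \<subseteq> Z" using r(1) b(1) B(2) by auto
  have Zrb: "Z \<subseteq> span (r ` S \<union> b)"
  proof
    fix z assume "z \<in> Z"
    then obtain T c where T: "finite T" "T \<subseteq> S" "z - (\<Sum>X\<in>T. c X *\<^sub>R r X) \<in> B"
      using gen by blast
    have "z - (\<Sum>X\<in>T. c X *\<^sub>R r X) \<in> span (r ` S \<union> b)"
      using T(3) spb span_mono[of b "r ` S \<union> b"] by blast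
    moreover have "(\<Sum>X\<in>T. c X *\<^sub>R r X) \<in> span (r ` S \<union> b)"
      using T(2) by (intro span_sum span_scale span_base) auto
    ultimately show "z \<in> span (r ` S \<union> b)"
      using span_add by fastforce
  qed
  have "dim Z = card (r ` S \<union> b)"
    using dim_unique[OF sub Zrb indrb refl] .
  moreover have "finite (r ` S \<union> b)"
    using independent_span_bound[OF Z(3) indrb subset_trans[OF sub Z(2)]] by blast
  ultimately show ?thesis
    using disj injr b(4) by (simp add: card_Un_disjoint card_image)
qed

text \<open>\<open>quot_dim\<close> selects a basis by \<open>SOME\<close>, so one has to exist. The
  cosets of the vectors that extend a basis of \<open>B\<close> to one of \<open>Z\<close> will
  do.\<close>

lemma quot_basis_exists:
  fixes B Z :: "'a::real_vector set"
  assumes B: "subspace B" "B \<subseteq> Z" and Z: "subspace Z"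
  shows "\<exists>S. quot_basis Z B S"
proof -
  obtain b where b: "b \<subseteq> B" "independent b" "B \<subseteq> span b" "card b = dim B"
    using basis_exists by blast
  have spb: "span b = B" using b(1,3) B(1) span_minimal by blast
  obtain C where C: "b \<subseteq> C" "C \<subseteq> Z" "independent C" "Z \<subseteq> span C"
    using maximal_independent_subset_extend[OF subset_trans[OF b(1) B(2)] b(2)] by blast
  define A where "A = C - b"
  have Ab: "independent (A \<union> b)" "A \<inter> b = {}"
    using C(1,3) by (auto simp: A_def Un_absorb2)
  have indA: "\<forall>x\<in>T. c x = 0" if "finite T" "T \<subseteq> A" "(\<Sum>x\<in>T. c x *\<^sub>R x) \<in> B" for T c
    using Ab(1) that unfolding independent_Un_iff[OF b(2) Ab(2)] spb by blast
  have inj: "inj_on (\<lambda>x. x +o B) A"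
  proof (rule inj_onI, rule ccontr)
    fix x y assume xy: "x \<in> A" "y \<in> A" "x +o B = y +o B" "x \<noteq> y"
    then have "x - y \<in> B" using coset_eq_iff[OF B(1)] by blast
    then show False
      using indA[of "{x, y}" "\<lambda>z. if z = x then 1 else -1"] xy by auto
  qed
  \<comment> \<open>\<open>A\<close> meets each coset at most once, so \<open>the_inv_into\<close>
    recovers representatives and turns coefficients on cosets into coefficients on vectors.\<close>
  have comb: "quot_lincomb B ((\<lambda>x. x +o B) ` T) c = (\<Sum>x\<in>T. c (x +o B) *\<^sub>R x) +o B"
    if T: "finite T" "T \<subseteq> A" for T c
  proof -
    let ?r = "the_inv_into A (\<lambda>x. x +o B)"
    have r: "?r (x +o B) = x" if "x \<in> T" for x
      using the_inv_into_f_f[OF inj] that T by auto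
    have "quot_lincomb B ((\<lambda>x. x +o B) ` T) c = (\<Sum>X\<in>(\<lambda>x. x +o B) ` T. c X *\<^sub>R ?r X) +o B"
      using T r by (intro quot_lincomb_eq[OF B(1)]) auto
    also have "(\<Sum>X\<in>(\<lambda>x. x +o B) ` T. c X *\<^sub>R ?r X) = (\<Sum>x\<in>T. c (x +o B) *\<^sub>R x)"
      using inj_on_subset[OF inj T(2)] r by (simp add: sum.reindex)
    finally show ?thesis .
  qed
  have "quot_basis Z B ((\<lambda>x. x +o B) ` A)"
    unfolding quot_basis_def
  proof (intro conjI allI impI ballI)
    show "(\<lambda>x. x +o B) ` A \<subseteq> quot_space Z B"
      using C(2) by (auto simp: quot_space_def A_def)
  next
    fix T c X
    assume T: "finite T \<and> T \<subseteq> (\<lambda>x. x +o B) ` A \<and> quot_lincomb B T c = B" and X: "X \<in> T"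
    obtain T' where T': "T' \<subseteq> A" "T = (\<lambda>x. x +o B) ` T'" using T by (meson subset_imageE)
    have fin: "finite T'" using T T' inj_on_subset[OF inj T'(1)] finite_image_iff by blast
    have "(\<Sum>x\<in>T'. c (x +o B) *\<^sub>R x) +o B = 0 +o B"
      using comb[OF fin T'(1)] T T'(2) by simp
    then have "(\<Sum>x\<in>T'. c (x +o B) *\<^sub>R x) \<in> B" by (simp only: coset_eq_iff[OF B(1)] diff_zero)
    then show "c X = 0"
      using indA[OF fin T'(1), of "\<lambda>x. c (x +o B)"] X T'(2) by auto
  next
    fix Y assume "Y \<in> quot_space Z B"
    then obtain z where z: "z \<in> Z" "Y = z +o B" by (auto simp: quot_space_def)
    obtain t r where t: "finite t" "t \<subseteq> C" "z = (\<Sum>x\<in>t. r x *\<^sub>R x)"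
      using z(1) C(4) unfolding span_explicit by auto
    \<comment> \<open>The rest of the expansion runs over \<open>b\<close> and lies in
      \<open>B\<close>, so it vanishes in the quotient.\<close>
    let ?T = "t \<inter> A"
    let ?c = "\<lambda>X. r (the_inv_into A (\<lambda>x. x +o B) X)"
    have cx: "?c (x +o B) = r x" if "x \<in> A" for x using the_inv_into_f_f[OF inj that] by simp
    have "z = (\<Sum>x\<in>?T. r x *\<^sub>R x) + (\<Sum>x\<in>t \<inter> b. r x *\<^sub>R x)"
      unfolding t(3) using t(1,2)
      by (subst sum.union_disjoint[symmetric]) (auto simp: A_def intro!: sum.cong)
    moreover have "(\<Sum>x\<in>t \<inter> b. r x *\<^sub>R x) \<in> B"
      unfolding spb[symmetric] by (intro span_sum span_scale span_base) auto
    ultimately have "(\<Sum>x\<in>?T. r x *\<^sub>R x) - z \<in> B"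
      using subspace_neg[OF B(1)] by auto
    moreover have "quot_lincomb B ((\<lambda>x. x +o B) ` ?T) ?c = (\<Sum>x\<in>?T. r x *\<^sub>R x) +o B"
      using t(1) cx by (subst comb) auto
    ultimately have "quot_lincomb B ((\<lambda>x. x +o B) ` ?T) ?c = Y"
      using coset_eq_iff[OF B(1)] z(2) by metis
    moreover have "finite ((\<lambda>x. x +o B) ` ?T)" "(\<lambda>x. x +o B) ` ?T \<subseteq> (\<lambda>x. x +o B) ` A"
      using t(1) by auto
    ultimately show "\<exists>T c. finite T \<and> T \<subseteq> (\<lambda>x. x +o B) ` A \<and> quot_lincomb B T c = Y"
      by blast
  qed
  then show ?thesis by blast
qed

lemma quot_dim_plus:
  fixes B Z :: "'a::real_vector set"
  assumes "subspace B" "B \<subseteq> Z" "subspace Z" "Z \<subseteq> span F" "finite F"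
  shows "quot_dim Z B + dim B = dim Z"
  unfolding quot_dim_def
  using card_quot_basis[OF assms someI_ex[OF quot_basis_exists[OF assms(1-3)]]] .

section \<open>Algebraic Morse inequalities\<close>

text \<open>Since \<open>\<Phi>\<close> is an idempotent chain map homotopic to the identity, its
  image D is a subcomplex with the same homology. Counting gives dim D_i = b_i + r_i + r_(i+1) with
  r_i the dimension of \<open>bd\<close> of D_i, and the alternating sum telescopes. The last rank
  is kept as a remainder, so that the result is an equality and can be multiplied by a sign.\<close>

lemma morse_of_idempotent_chain_homotopy:
  fixes bd V \<Phi> :: "'a::real_vector \<Rightarrow> 'a" and C :: "nat \<Rightarrow> 'a set"
  assumes \<Phi>_def: "\<And>x. \<Phi> x = x + bd (V x) + V (bd x)"
    and bd: "linear bd" and V: "linear V"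
    and C: "\<And>n. subspace (C n)" "\<And>n. C n \<subseteq> span (F n)" "\<And>n. finite (F n)"
    and bdC: "\<And>n x. x \<in> C (Suc n) \<Longrightarrow> bd x \<in> C n" and bd0: "\<And>x. x \<in> C 0 \<Longrightarrow> bd x = 0"
    and bdbd: "\<And>n x. x \<in> C n \<Longrightarrow> bd (bd x) = 0"
    and VC: "\<And>n x. x \<in> C n \<Longrightarrow> V x \<in> C (Suc n)"
    and idem: "\<And>n x. x \<in> C n \<Longrightarrow> \<Phi> (\<Phi> x) = \<Phi> x"
  shows "(\<Sum>i\<le>m. (-1) ^ (m - i) * int (dim (\<Phi> ` C i))) =
    (\<Sum>i\<le>m. (-1) ^ (m - i) * int (quot_dim {x \<in> C i. bd x = 0} (bd ` C (i + 1))))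
      + int (dim (bd ` \<Phi> ` C (Suc m)))"
proof -
  have "linear (\<lambda>x. x + bd (V x) + V (bd x))"
    using linear_compose[OF V bd] linear_compose[OF bd V]
    by (intro linear_compose_add linear_id[unfolded id_def]) (auto simp: o_def)
  then have lin: "linear \<Phi>" by (simp add: \<Phi>_def[abs_def])
  let ?Z = "\<lambda>i. {x \<in> C i. bd x = 0}" and ?B = "\<lambda>i. bd ` C (Suc i)" and ?D = "\<lambda>i. \<Phi> ` C i"
  have BZ: "?B i \<subseteq> ?Z i" for i using bdC bdbd by auto
  have subB: "subspace (?B i)" for i using linear_subspace_image[OF bd C(1)] .
  have subZ: "subspace (?Z i)" for i
    using subspace_kernel_on[OF bd C(1)] .
  have Zfin: "?Z i \<subseteq> span (F i)" for i using C(2)[of i] by auto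
  have b: "quot_dim (?Z i) (?B i) + dim (?B i) = dim (?Z i)" for i
    using quot_dim_plus[OF subB BZ subZ Zfin C(3)] .
  \<comment> \<open>\<open>V\<close> restores the degree that \<open>bd\<close> lowers; in degree 0
    there is nothing below, but \<open>bd x\<close> vanishes.\<close>
  have VbdC: "V (bd x) \<in> C i" if "x \<in> C i" for i x
  proof (cases i)
    case 0
    then show ?thesis
      using bd0 that linear_0[OF V] subspace_0[OF C(1)[of 0]] by auto
  next
    case (Suc j)
    then show ?thesis using bdC VC that by auto
  qed
  have DC: "?D i \<subseteq> C i" for i
    unfolding \<Phi>_def using VbdC bdC VC by (auto intro!: subspace_add[OF C(1)])
  have comm: "bd (\<Phi> x) = \<Phi> (bd x)" if "x \<in> C i" for i x
    using bdbd[OF that] bdbd[OF VC[OF that]]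
    by (simp add: \<Phi>_def linear_add[OF bd] linear_0[OF V])
  have fixD: "\<Phi> x = x" if "x \<in> ?D i" for i x using that idem by auto
  \<comment> \<open>Elements of the image are fixed by \<open>\<Phi>\<close>, so a cycle in the
    image is its own preimage.\<close>
  have ZD: "{x \<in> ?D i. bd x = 0} = \<Phi> ` ?Z i" for i
  proof (intro subset_antisym subsetI)
    fix x assume x: "x \<in> {x \<in> ?D i. bd x = 0}"
    then have "x \<in> ?Z i" using DC by blast
    moreover have "x = \<Phi> x" using fixD[of x i] x by simp
    ultimately show "x \<in> \<Phi> ` ?Z i" by (rule rev_image_eqI)
  next
    fix x assume "x \<in> \<Phi> ` ?Z i"
    then show "x \<in> {x \<in> ?D i. bd x = 0}"
      using comm linear_0[OF lin] by fastforce
  qed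
  have BD: "bd ` ?D (Suc i) = \<Phi> ` ?B i" for i
    using comm by (auto simp: image_image intro!: image_cong)
  text \<open>On cycles \<open>\<Phi>\<close> is homotopic to the identity, so its kernel there consists of boundaries.\<close>
  have ker: "{x \<in> ?Z i. \<Phi> x = 0} = {x \<in> ?B i. \<Phi> x = 0}" for i
  proof (intro subset_antisym subsetI)
    fix x assume x: "x \<in> {x \<in> ?Z i. \<Phi> x = 0}"
    then have "x + bd (V x) = 0" by (auto simp: \<Phi>_def linear_0[OF V])
    then have "x = bd (- V x)" by (simp add: linear_neg[OF bd] eq_neg_iff_add_eq_0)
    moreover have "- V x \<in> C (Suc i)" using x VC subspace_neg[OF C(1)] by blast
    ultimately show "x \<in> {x \<in> ?B i. \<Phi> x = 0}" using x by blast
  qed (use BZ in blast)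
  have Bfin: "?B i \<subseteq> span (F i)" for i using BZ Zfin by blast
  \<comment> \<open>The kernels of \<open>\<Phi>\<close> on cycles and on boundaries agree by
    \<open>ker\<close>, so they cancel in the difference that is the Betti number.\<close>
  have rn1: "dim (?Z i) = dim {x \<in> ?Z i. \<Phi> x = 0} + dim (\<Phi> ` ?Z i)" for i
    by (rule dim_kernel_plus_image[OF lin subZ Zfin C(3)])
  have rn2: "dim (?B i) = dim {x \<in> ?B i. \<Phi> x = 0} + dim (\<Phi> ` ?B i)" for i
    by (rule dim_kernel_plus_image[OF lin subB Bfin C(3)])
  have rn3: "dim (?D i) = dim (\<Phi> ` ?Z i) + dim (bd ` ?D i)" for i
    unfolding ZD[symmetric]
    by (rule dim_kernel_plus_image[OF bd linear_subspace_image[OF lin C(1)] _ C(3)])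
      (use DC C(2) in blast)
  have step: "int (dim (?D i)) = int (quot_dim (?Z i) (?B i)) + int (dim (bd ` ?D i))
      + int (dim (bd ` ?D (Suc i)))" for i
    using b[of i] rn1[of i] rn2[of i] rn3[of i] ker[of i] BD[of i] by simp
  have r0: "dim (bd ` ?D 0) = 0"
  proof -
    have "bd ` ?D 0 \<subseteq> {0}" using bd0 DC by auto
    then show ?thesis using dim_le_card[of "bd ` ?D 0" "{}"] by auto
  qed
  have "(\<Sum>i\<le>m. (-1) ^ (m - i) * int (dim (?D i))) =
    (\<Sum>i\<le>m. (-1) ^ (m - i) * int (quot_dim (?Z i) (?B i))) + int (dim (bd ` ?D (Suc m)))"
  proof (induction m)
    case 0
    then show ?case using step[of 0] r0 by simp
  next
    case (Suc m)
    \<comment> \<open>Peeling off the top term negates the rest, so the rank shared by degrees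
      \<open>m\<close> and \<open>Suc m\<close> cancels.\<close>
    have s: "(\<Sum>i\<le>Suc m. (-1) ^ (Suc m - i) * g i) = g (Suc m) - (\<Sum>i\<le>m. (-1) ^ (m - i) * g i)"
      for g :: "nat \<Rightarrow> int"
      by (simp add: Suc_diff_le sum_negf[symmetric])
    show ?case unfolding s Suc.IH using step[of "Suc m"] by simp
  qed
  then show ?thesis by simp
qed

section \<open>The boundary operator\<close>

lemma lookup_scaleR [simp]:
  "Poly_Mapping.lookup (r *\<^sub>R x) p = r * Poly_Mapping.lookup x p" for x :: "'v chain"
proof -
  have "finite {i. r *\<^sub>R Poly_Mapping.lookup x i \<noteq> 0}"
    by (rule finite_subset[OF _ finite_keys[of x]]) (auto simp: in_keys_iff)
  then show ?thesis unfolding scaleR_poly_mapping_def by simp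
qed

lemma keys_elem [simp]: "Poly_Mapping.keys (elem p) = {p}"
  by (simp add: elem_def)

lemma lookup_elem: "Poly_Mapping.lookup (elem p) q = (if p = q then 1 else 0)"
  by (simp add: elem_def lookup_single)

lemma chain_inner_elem: "chain_inner x (elem p) = Poly_Mapping.lookup x p"
  unfolding chain_inner_def by (simp add: lookup_elem in_keys_iff sum.delta' if_distrib cong: if_cong)

text \<open>A common finite index set allows the sums for different chains to be compared.\<close>

lemma linear_extension_superset:
  assumes "finite S" "Poly_Mapping.keys x \<subseteq> S"
  shows "linear_extension g x = (\<Sum>p\<in>S. Poly_Mapping.lookup x p *\<^sub>R g p)"
  unfolding linear_extension_def
  by (rule sum.mono_neutral_left[OF assms]) (simp add: in_keys_iff)

lemma linear_linear_extension: "linear (linear_extension g)"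
proof
  fix x y :: "'a chain"
  let ?S = "Poly_Mapping.keys x \<union> Poly_Mapping.keys y"
  show "linear_extension g (x + y) = linear_extension g x + linear_extension g y"
    using keys_add[of x y]
    by (simp add: linear_extension_superset[of ?S] lookup_add scaleR_add_left sum.distrib)
next
  fix r and x :: "'a chain"
  have "Poly_Mapping.keys (r *\<^sub>R x) \<subseteq> Poly_Mapping.keys x"
    by (auto simp: in_keys_iff)
  then show "linear_extension g (r *\<^sub>R x) = r *\<^sub>R linear_extension g x"
    by (simp add: linear_extension_superset[of "Poly_Mapping.keys x"] scaleR_sum_right)
qed

lemma linear_extension_elem [simp]: "linear_extension g (elem p) = g p"
  by (simp add: linear_extension_def lookup_elem)

lemma span_range_elem: "span (range elem) = UNIV"
proof -
  have "x \<in> span (range elem)" for x :: "'a chain"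
  proof -
    have "x = (\<Sum>p\<in>Poly_Mapping.keys x. Poly_Mapping.lookup x p *\<^sub>R elem p)"
      by (rule poly_mapping_eqI)
        (simp add: lookup_sum lookup_elem in_keys_iff sum.delta if_distrib cong: if_cong)
    then show ?thesis by (metis (no_types, lifting) rangeI span_base span_scale span_sum)
  qed
  then show ?thesis by blast
qed

text \<open>The basis consists of all lists, allowed or not, so operator identities checked on
  \<open>elem p\<close> hold for every chain and not only on some \<open>P G n\<close>.\<close>

lemma linear_eq_on_elem:
  assumes "linear g" "linear h" "\<And>p. g (elem p) = h (elem p)"
  shows "g x = h x"
  using linear_eq_on_span[OF assms(1,2), of "range elem" x] assms(3) span_range_elem by auto

section \<open>Faces of paths and the boundary of a boundary\<close>

definition del_nth :: "nat \<Rightarrow> 'v list \<Rightarrow> 'v list" where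
  "del_nth i p = take i p @ drop (Suc i) p"

lemma length_del_nth [simp]: "i < length p \<Longrightarrow> length (del_nth i p) = length p - 1"
  by (simp add: del_nth_def)

lemma insert_nth_del_nth: "i < length p \<Longrightarrow> p = take i p @ p ! i # drop (Suc i) p"
  by (rule id_take_nth_drop)

lemma set_del_nth: "distinct p \<Longrightarrow> i < length p \<Longrightarrow> set (del_nth i p) = set p - {p ! i}"
proof -
  assume "distinct p" "i < length p"
  then have "distinct (take i p @ p ! i # drop (Suc i) p)"
    and "set p = set (take i p @ p ! i # drop (Suc i) p)"
    using insert_nth_del_nth[of i p] by auto
  then show ?thesis by (auto simp: del_nth_def)
qed

text \<open>The vertex missing from the set of entries determines the position. With repetitions
  this fails: both faces of \<open>[u, u]\<close> are \<open>[u]\<close>.\<close>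

lemma del_nth_inj:
  assumes "distinct p" "i < length p" "j < length p" "del_nth i p = del_nth j p"
  shows "i = j"
proof -
  have "set p - {p ! i} = set p - {p ! j}" using assms set_del_nth by metis
  then have "p ! i = p ! j" using assms(2,3) nth_mem by blast
  then show ?thesis using assms by (simp add: nth_eq_iff_index_eq)
qed

lemma strict_subseq_del_nth: "i < length p \<Longrightarrow> strict_subseq (del_nth i p) p"
proof -
  assume i: "i < length p"
  have "subseq (del_nth i p) (take i p @ p ! i # drop (Suc i) p)"
    unfolding del_nth_def by (intro list_emb_append_mono list_emb_Cons) auto
  moreover have "del_nth i p \<noteq> p"
  proof
    assume "del_nth i p = p"
    then show False using length_del_nth[OF i] i by simp
  qed
  ultimately show ?thesis using insert_nth_del_nth[OF i] by (simp add: subseq_order.less_le)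
qed

text \<open>Links the faces of the Morse condition, given by the subsequence order, with the indexed
  faces of the boundary. After the first skipped entry the lengths agree, so the remaining lists are
  equal.\<close>

lemma subseq_length_Suc:
  assumes "subseq p q" "length q = Suc (length p)"
  shows "\<exists>i<length q. p = del_nth i q"
  using assms
proof (induction rule: list_emb.induct)
  case (list_emb_Nil ys)
  then show ?case by (auto simp: del_nth_def)
next
  case (list_emb_Cons xs ys y)
  have "xs = ys"
    using subseq_same_length[OF list_emb_Cons.hyps] list_emb_Cons.prems by simp
  then have "xs = del_nth 0 (y # ys)" by (simp add: del_nth_def)
  then show ?case by blast
next
  case (list_emb_Cons2 x y xs ys)
  have "length ys = Suc (length xs)" using list_emb_Cons2.prems by simp
  then obtain i where "i < length ys" "xs = del_nth i ys" using list_emb_Cons2.IH by blast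
  then have "Suc i < length (y # ys)" "x # xs = del_nth (Suc i) (y # ys)"
    using list_emb_Cons2.hyps(1) by (simp_all add: del_nth_def)
  then show ?case by blast
qed

lemma path_value_del_nth:
  assumes "i < length p" shows "path_value f p = path_value f (del_nth i p) + f (p ! i)"
proof -
  have "path_value f p = path_value f (take i p @ p ! i # drop (Suc i) p)"
    using insert_nth_del_nth[OF assms] by simp
  then show ?thesis by (simp add: path_value_def del_nth_def)
qed

lemma linear_boundary: "linear boundary"
  unfolding boundary_def by (rule linear_linear_extension)

lemma boundary_elem:
  "boundary (elem p) =
    (if length p \<le> 1 then 0 else (\<Sum>i<length p. (-1) ^ i *\<^sub>R elem (del_nth i p)))"
  by (simp add: boundary_def del_nth_def)

text \<open>The boundary of the augmented complex, in which the empty path is a face of every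
  \<open>0\<close>-path, satisfies a recursion over the cone on the first vertex that makes \<open>\<partial>\<partial> = 0\<close> an
  induction.\<close>

definition aug_boundary :: "'v chain \<Rightarrow> 'v chain" where
  "aug_boundary = linear_extension (\<lambda>p. \<Sum>i<length p. (-1) ^ i *\<^sub>R elem (del_nth i p))"

definition cone :: "'v \<Rightarrow> 'v chain \<Rightarrow> 'v chain" where
  "cone a = linear_extension (\<lambda>p. elem (a # p))"

text \<open>Face 0 of \<open>a # p\<close> is \<open>p\<close>, and face \<open>i + 1\<close> is the
  cone over face \<open>i\<close> of \<open>p\<close> with the opposite sign.\<close>

lemma aug_boundary_cone: "aug_boundary (cone a x) = x - cone a (aug_boundary x)"
proof (rule linear_eq_on_elem[of "\<lambda>x. aug_boundary (cone a x)"])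
  have lc: "linear (cone a)" and lb: "linear aug_boundary"
    by (simp_all add: cone_def aug_boundary_def linear_linear_extension)
  show "linear (\<lambda>x. aug_boundary (cone a x))"
    using linear_compose[OF lc lb] by (simp add: o_def)
  show "linear (\<lambda>x. x - cone a (aug_boundary x))"
    using linear_compose[OF lb lc]
    by (intro linear_compose_sub linear_id[unfolded id_def]) (simp add: o_def)
  fix p
  show "aug_boundary (cone a (elem p)) = elem p - cone a (aug_boundary (elem p))"
    unfolding aug_boundary_def linear_extension_elem cone_def length_Cons sum.lessThan_Suc_shift
      linear_sum[OF linear_linear_extension] linear_scale[OF linear_linear_extension]
    by (simp add: del_nth_def sum_negf)
qed

lemma aug_boundary_aug_boundary: "aug_boundary (aug_boundary x) = 0"
proof (rule linear_eq_on_elem[of "\<lambda>x. aug_boundary (aug_boundary x)" "\<lambda>_. 0"])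
  have lb: "linear (aug_boundary :: 'a chain \<Rightarrow> _)"
    by (simp add: aug_boundary_def linear_linear_extension)
  then show "linear (\<lambda>x :: 'a chain. aug_boundary (aug_boundary x))"
    using linear_compose[OF lb lb] by (simp add: o_def)
  show "linear (\<lambda>x :: 'a chain. 0 :: 'a chain)" by (rule linear_zero)
  fix p :: "'a list"
  show "aug_boundary (aug_boundary (elem p)) = 0"
  proof (induction p)
    case Nil
    show ?case using linear_0[OF lb] by (simp add: aug_boundary_def)
  next
    case (Cons a p)
    have "elem (a # p) = cone a (elem p)" by (simp add: cone_def)
    then have "aug_boundary (aug_boundary (elem (a # p))) =
        aug_boundary (elem p) - (aug_boundary (elem p) - cone a (aug_boundary (aug_boundary (elem p))))"
      by (simp add: aug_boundary_cone linear_diff[OF lb])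
    also have "\<dots> = cone a 0" using Cons by simp
    finally show ?case by (simp add: cone_def linear_0[OF linear_linear_extension])
  qed
qed

text \<open>\<open>boundary\<close> and \<open>aug_boundary\<close> differ only on lists with one
  entry. These occur as faces only of lists of length 2, which are treated directly.\<close>

lemma boundary_boundary: "boundary (boundary x) = 0"
proof (rule linear_eq_on_elem[of "\<lambda>x. boundary (boundary x)" "\<lambda>_. 0"])
  show "linear (\<lambda>x :: 'a chain. boundary (boundary x))"
    using linear_compose[OF linear_boundary linear_boundary] by (simp add: o_def)
  show "linear (\<lambda>x :: 'a chain. 0 :: 'a chain)" by (rule linear_zero)
  fix p :: "'a list"
  have lb: "linear (aug_boundary :: 'a chain \<Rightarrow> _)"
    by (simp add: aug_boundary_def linear_linear_extension)
  have eq: "boundary (elem q) = aug_boundary (elem q)" if "length q \<ge> 2" for q :: "'a list"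
    using that by (simp add: boundary_elem aug_boundary_def)
  consider "length p \<le> 1" | "length p = 2" | "length p \<ge> 3" by linarith
  then show "boundary (boundary (elem p)) = 0"
  proof cases
    case 1
    then show ?thesis using linear_0[OF linear_boundary] by (simp add: boundary_elem)
  next
    case 2
    then have "boundary (boundary (elem p)) =
        (\<Sum>i<length p. (-1) ^ i *\<^sub>R boundary (elem (del_nth i p)))"
      by (simp add: boundary_elem[of p] linear_sum[OF linear_boundary] linear_scale[OF linear_boundary]
          del: One_nat_def)
    also have "\<dots> = 0" using 2 by (intro sum.neutral) (simp add: boundary_elem)
    finally show ?thesis .
  next
    case 3
    then have "boundary (boundary (elem p)) =
        (\<Sum>i<length p. (-1) ^ i *\<^sub>R boundary (elem (del_nth i p)))"
      by (simp add: boundary_elem[of p] linear_sum[OF linear_boundary] linear_scale[OF linear_boundary]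
          del: One_nat_def)
    also have "\<dots> = (\<Sum>i<length p. (-1) ^ i *\<^sub>R aug_boundary (elem (del_nth i p)))"
      using 3 by (intro sum.cong) (simp_all add: eq)
    also have "\<dots> = aug_boundary (aug_boundary (elem p))"
      by (simp add: aug_boundary_def linear_sum[OF linear_linear_extension]
          linear_scale[OF linear_linear_extension])
    finally show ?thesis by (simp add: aug_boundary_aug_boundary)
  qed
qed

text \<open>The faces of \<open>q\<close> are pairwise different, so no cancellation occurs. This is
  the incidence number in the definition of \<open>grad\<close>.\<close>

lemma lookup_boundary_elem:
  assumes "distinct q" "2 \<le> length q" "j < length q"
  shows "Poly_Mapping.lookup (boundary (elem q)) (del_nth j q) = (-1) ^ j"
proof -
  have e: "del_nth i q = del_nth j q \<longleftrightarrow> i = j" if "i < length q" for i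
    using del_nth_inj[OF assms(1) that assms(3)] by blast
  have "(\<Sum>i<length q. (-1) ^ i * (if del_nth i q = del_nth j q then 1 else 0)) =
      (\<Sum>i<length q. if i = j then (-1) ^ i else (0::real))"
    by (rule sum.cong) (simp_all add: e)
  then have "Poly_Mapping.lookup (boundary (elem q)) (del_nth j q) =
      (\<Sum>i<length q. if i = j then (-1) ^ i else 0)"
    using assms(2) by (simp add: boundary_elem lookup_sum lookup_elem)
  also have "\<dots> = (-1) ^ j" using assms(3) by simp
  finally show ?thesis .
qed

section \<open>The gradient flow on a transitive digraph\<close>

lemma finite_paths:
  assumes "finite (pverts K)"
  shows "finite {p. allowed K p \<and> length p = n}"
  by (rule finite_subset[OF _ finite_lists_length_eq[OF assms, of n]]) (auto simp: allowed_def)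

lemma finite_level_cofaces: "finite (pverts K) \<Longrightarrow> finite (level_cofaces K f p)"
  by (rule finite_subset[OF _ finite_paths[of K "length p + 1"]]) (auto simp: level_cofaces_def)

lemma finite_level_faces: "finite (pverts K) \<Longrightarrow> finite (level_faces K f p)"
  by (rule finite_subset[OF _ finite_paths[of K "length p - 1"]]) (auto simp: level_faces_def)

text \<open>The values of a path and of its face differ by the value of the removed vertex, which
  therefore is 0 for a level pair.\<close>

lemma level_cofaces_del_nth:
  assumes "q \<in> level_cofaces K f p"
  shows "\<exists>j<length q. p = del_nth j q \<and> f (q ! j) = 0"
proof -
  have "subseq p q" "length q = Suc (length p)" "path_value f q = path_value f p"
    using assms by (auto simp: level_cofaces_def subseq_order.less_le)
  then obtain j where j: "j < length q" "p = del_nth j q" using subseq_length_Suc by blast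
  moreover have "f (q ! j) = 0"
    using path_value_del_nth[OF j(1), of f] j(2) \<open>path_value f q = path_value f p\<close> by simp
  ultimately show ?thesis by blast
qed

lemma level_cofacesI:
  assumes "allowed K q" "j < length q" "f (q ! j) = 0"
  shows "q \<in> level_cofaces K f (del_nth j q)"
  using assms strict_subseq_del_nth[OF assms(2)] path_value_del_nth[OF assms(2), of f]
  by (auto simp: level_cofaces_def)

lemma level_coface_if_level_face: "p \<in> level_faces K f q \<Longrightarrow> allowed K q \<Longrightarrow> q \<in> level_cofaces K f p"
  by (auto simp: level_faces_def level_cofaces_def)

lemma allowed_mono: "contained_in G K \<Longrightarrow> allowed G p \<Longrightarrow> allowed K p"
  unfolding contained_in_def allowed_def
  by (auto intro: successively_mono[of "\<lambda>u v. (u, v) \<in> parcs G"])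

lemma linear_grad: "linear (grad K f)"
  unfolding grad_def by (rule linear_linear_extension)

lemma linear_flow: "linear (flow K f)"
proof -
  have "linear (\<lambda>x. x + boundary (grad K f x) + grad K f (boundary x))"
    using linear_compose[OF linear_grad linear_boundary] linear_compose[OF linear_boundary linear_grad]
    by (intro linear_compose_add linear_id[unfolded id_def]) (auto simp: o_def)
  then show ?thesis by (simp add: flow_def[abs_def])
qed

section \<open>Coordinate projections on chains\<close>

definition select :: "('v list \<Rightarrow> bool) \<Rightarrow> 'v chain \<Rightarrow> 'v chain" where
  "select Q = linear_extension (\<lambda>p. if Q p then elem p else 0)"

lemma linear_select: "linear (select Q)"
  unfolding select_def by (rule linear_linear_extension)

lemma select_elem: "select Q (elem p) = (if Q p then elem p else 0)"
  by (simp add: select_def)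

lemma select_select: "select Q (select Q x) = select Q x"
proof (rule linear_eq_on_elem[of "\<lambda>x. select Q (select Q x)" "select Q"])
  show "linear (\<lambda>x. select Q (select Q x))"
    using linear_compose[OF linear_select linear_select] by (simp add: o_def)
qed (simp_all add: linear_select select_elem linear_0)

lemma select_Crit: "x \<in> Crit K f n \<Longrightarrow> select (critical K f) x = x"
  unfolding Crit_def
  by (rule linear_eq_on_span[OF linear_select linear_id[unfolded id_def],
        where B = "{elem p |p. critical K f p \<and> length p = n + 1}"])
    (auto simp: select_elem)

section \<open>Zero vertices and level pairs\<close>

locale transitive_morse =
  fixes H :: "'v pair_pre_digraph" and f :: "'v \<Rightarrow> real"
  assumes transitive: "transitive_digraph H" and morse: "discrete_morse H f"
begin

abbreviation "V \<equiv> grad H f"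
abbreviation "\<Phi> \<equiv> flow H f"
abbreviation "\<kappa> \<equiv> select (critical H f)"
text \<open>On the boundary of an allowed path with a zero vertex and at least one more vertex, this
  projection keeps exactly the face without the zero vertex, and so undoes \<open>V\<close> up to
  sign.\<close>

abbreviation "\<sigma> \<equiv> select (\<lambda>p. \<forall>v\<in>set p. f v \<noteq> 0)"

lemma finite_pverts: "finite (pverts H)"
  using transitive
  by (simp add: transitive_digraph_def is_digraph_def pair_digraph_def pair_fin_digraph_def
      pair_fin_digraph_axioms_def)

lemma trans_parcs: "trans (parcs H)"
  using transitive by (simp add: transitive_digraph_def)

lemma loopfree: "(v, v) \<notin> parcs H"
proof -
  interpret pair_digraph H using transitive by (simp add: transitive_digraph_def is_digraph_def)
  show ?thesis using pair_no_loops by force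
qed

text \<open>Transitivity turns edges between consecutive vertices into edges between all ordered
  pairs, a condition inherited by subsequences.\<close>

lemma allowed_iff:
  "allowed H p \<longleftrightarrow> p \<noteq> [] \<and> set p \<subseteq> pverts H \<and> sorted_wrt (\<lambda>u v. (u, v) \<in> parcs H) p"
proof -
  have "transp (\<lambda>u v. (u, v) \<in> parcs H)" using trans_parcs by (simp add: trans_def transp_def)
  then show ?thesis by (simp add: allowed_def successively_conv_sorted_wrt)
qed

lemma distinct_allowed: "allowed H p \<Longrightarrow> distinct p"
  unfolding allowed_iff distinct_conv_nth sorted_wrt_iff_nth_less
  using loopfree by (metis linorder_neqE_nat)

text \<open>The bound on the length keeps the face nonempty, as the empty list is not
  allowed.\<close>

lemma allowed_del_nth:
  assumes "allowed H p" "i < length p" "2 \<le> length p"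
  shows "allowed H (del_nth i p)"
proof -
  have "sorted_wrt (\<lambda>u v. (u, v) \<in> parcs H) (take i p @ p ! i # drop (Suc i) p)"
    and "set (take i p @ p ! i # drop (Suc i) p) \<subseteq> pverts H"
    using assms insert_nth_del_nth[of i p] by (auto simp: allowed_iff)
  moreover have "del_nth i p \<noteq> []"
    using length_del_nth[OF assms(2)] assms(3) by (cases "del_nth i p") auto
  ultimately show ?thesis by (auto simp: allowed_iff del_nth_def sorted_wrt_append)
qed

text \<open>The path \<open>q\<close> is a level coface of this face, and the Morse condition leaves
  room for only one.\<close>

lemma level_coface_zero:
  assumes "allowed H q" "2 \<le> length q" "j < length q" "f (q ! j) = 0"
  shows "level_cofaces H f (del_nth j q) = {q}"
proof -
  have "q \<in> level_cofaces H f (del_nth j q)" using assms level_cofacesI by blast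
  moreover have "card (level_cofaces H f (del_nth j q)) \<le> 1"
    using morse allowed_del_nth[OF assms(1,3,2)] by (simp add: discrete_morse_def)
  ultimately show ?thesis
    using finite_level_cofaces[OF finite_pverts, of f "del_nth j q"]
    by (auto simp: card_le_Suc0_iff_eq)
qed

lemma level_face_zero:
  assumes "allowed H q" "2 \<le> length q" "j < length q" "f (q ! j) = 0"
  shows "del_nth j q \<in> level_faces H f q"
  using assms allowed_del_nth[OF assms(1,3,2)] strict_subseq_del_nth[OF assms(3)]
    path_value_del_nth[OF assms(3), of f]
  by (simp add: level_faces_def)

text \<open>Removing either of two zero vertices would give two different level faces of
  \<open>q\<close>.\<close>

lemma zero_unique:
  assumes q: "allowed H q" and ij: "i < length q" "j < length q" "f (q ! i) = 0" "f (q ! j) = 0"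
  shows "i = j"
proof (rule ccontr)
  assume "i \<noteq> j"
  then have len: "2 \<le> length q" using ij by linarith
  have "card (level_faces H f q) \<le> Suc 0" using morse q by (simp add: discrete_morse_def)
  then have "del_nth i q = del_nth j q"
    using level_face_zero[OF q len] ij finite_level_faces[OF finite_pverts, of f q]
    by (auto simp: card_le_Suc0_iff_eq)
  then show False using del_nth_inj[OF distinct_allowed[OF q]] ij \<open>i \<noteq> j\<close> by blast
qed

lemma zero_free_del_nth:
  assumes "allowed H q" "i < length q" "j < length q" "f (q ! j) = 0"
  shows "(\<forall>v\<in>set (del_nth i q). f v \<noteq> 0) \<longleftrightarrow> i = j"
proof
  assume nz: "\<forall>v\<in>set (del_nth i q). f v \<noteq> 0"
  show "i = j"
  proof (rule ccontr)
    assume "i \<noteq> j"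
    then have "q ! i \<noteq> q ! j"
      using distinct_allowed[OF assms(1)] assms by (simp add: nth_eq_iff_index_eq)
    then have "q ! j \<in> set (del_nth i q)"
      using set_del_nth[OF distinct_allowed[OF assms(1)] assms(2)] assms(3) by simp
    then show False using nz assms(4) by blast
  qed
next
  assume "i = j"
  show "\<forall>v\<in>set (del_nth i q). f v \<noteq> 0"
  proof (intro ballI notI)
    fix v assume v: "v \<in> set (del_nth i q)" "f v = 0"
    then have "v \<in> set q" "v \<noteq> q ! i"
      using set_del_nth[OF distinct_allowed[OF assms(1)] assms(2)] by auto
    then obtain k where "k < length q" "v = q ! k" "k \<noteq> i" by (metis in_set_conv_nth)
    then show False using zero_unique[OF assms(1), of k j] assms v \<open>i = j\<close> by blast
  qed
qed

text \<open>A level coface adds a zero vertex, and an allowed path has room for only one.\<close>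

lemma level_cofaces_zero:
  assumes "v \<in> set p" "f v = 0"
  shows "level_cofaces H f p = {}"
proof (rule ccontr)
  assume "level_cofaces H f p \<noteq> {}"
  then obtain q where q: "q \<in> level_cofaces H f p" by blast
  then obtain j where "j < length q" "p = del_nth j q" "f (q ! j) = 0"
    using level_cofaces_del_nth by blast
  moreover have "allowed H q" using q by (simp add: level_cofaces_def)
  ultimately show False using zero_free_del_nth[of q j j] assms by blast
qed

section \<open>The gradient and the idempotence of the flow\<close>

lemma grad_elem_eq_0: "level_cofaces H f p = {} \<Longrightarrow> V (elem p) = 0"
  by (simp add: grad_def)

lemma grad_del_nth:
  assumes "allowed H q" "2 \<le> length q" "j < length q" "f (q ! j) = 0"
  shows "V (elem (del_nth j q)) = - ((-1) ^ j *\<^sub>R elem q)"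
  using level_coface_zero[OF assms] allowed_del_nth[OF assms(1,3,2)]
    lookup_boundary_elem[OF distinct_allowed[OF assms(1)] assms(2,3)]
  by (simp add: grad_def chain_inner_elem)

text \<open>Every face other than the one with index \<open>j\<close> still contains the zero
  vertex, hence has no level coface and is killed by \<open>V\<close>. On the remaining face the two
  signs multiply to 1.\<close>

lemma grad_boundary_elem:
  assumes "allowed H q" "2 \<le> length q" "j < length q" "f (q ! j) = 0"
  shows "V (boundary (elem q)) = - elem q"
proof -
  have "V (boundary (elem q)) = (\<Sum>i<length q. (-1) ^ i *\<^sub>R V (elem (del_nth i q)))"
    using assms(2)
    by (simp add: boundary_elem linear_sum[OF linear_grad] linear_scale[OF linear_grad])
  also have "\<dots> = (\<Sum>i<length q. if i = j then - elem q else 0)"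
  proof (rule sum.cong)
    fix i assume i: "i \<in> {..<length q}"
    show "(-1) ^ i *\<^sub>R V (elem (del_nth i q)) = (if i = j then - elem q else 0)"
    proof (cases "i = j")
      case True
      then show ?thesis using grad_del_nth[OF assms] by (simp add: power_mult_distrib[symmetric])
    next
      case False
      then have "\<exists>v\<in>set (del_nth i q). f v = 0"
        using zero_free_del_nth[of q i j] assms i by auto
      then have "V (elem (del_nth i q)) = 0" using level_cofaces_zero grad_elem_eq_0 by blast
      then show ?thesis using False by simp
    qed
  qed simp
  also have "\<dots> = - elem q" using assms(3) by simp
  finally show ?thesis .
qed

text \<open>The bound on the length of \<open>q\<close> comes from \<open>p\<close> being allowed
  and hence nonempty.\<close>

lemma grad_elem_cases:
  obtains (zero) "V (elem p) = 0"
  | (source) q j where "allowed H q" "2 \<le> length q" "j < length q" "f (q ! j) = 0"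
      "p = del_nth j q" "V (elem p) = - ((-1) ^ j *\<^sub>R elem q)"
proof (cases "allowed H p \<and> level_cofaces H f p \<noteq> {}")
  case True
  then obtain q where q: "q \<in> level_cofaces H f p" by blast
  then obtain j where j: "j < length q" "p = del_nth j q" "f (q ! j) = 0"
    using level_cofaces_del_nth by blast
  have "allowed H q" "2 \<le> length q"
    using q True by (auto simp: level_cofaces_def allowed_def Suc_le_eq)
  then show ?thesis using source j grad_del_nth by blast
next
  case False
  then have "V (elem p) = 0" by (auto simp: grad_def)
  then show ?thesis by (rule zero)
qed

lemma grad_elem_zero:
  assumes "j < length q" "f (q ! j) = 0" shows "V (elem q) = 0"
  using level_cofaces_zero[of "q ! j" q] assms grad_elem_eq_0 by simp

text \<open>Values of \<open>V\<close> are combinations of paths with a zero vertex, and on these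
  \<open>V\<close> vanishes.\<close>

lemma grad_grad: "V (V x) = 0"
proof (rule linear_eq_on_elem[of "\<lambda>x. V (V x)" "\<lambda>_. 0"])
  show "linear (\<lambda>x. V (V x))"
    using linear_compose[OF linear_grad linear_grad] by (simp add: o_def)
  show "linear (\<lambda>x :: 'v chain. 0 :: 'v chain)" by (rule linear_zero)
  show "V (V (elem p)) = 0" for p
    by (cases p rule: grad_elem_cases)
      (auto simp: linear_0[OF linear_grad] linear_neg[OF linear_grad] linear_scale[OF linear_grad]
        grad_elem_zero)
qed

lemma grad_boundary_grad: "V (boundary (V x)) = - V x"
proof (rule linear_eq_on_elem[of "\<lambda>x. V (boundary (V x))"])
  show "linear (\<lambda>x. V (boundary (V x)))"
    using linear_compose[OF linear_compose[OF linear_grad linear_boundary] linear_grad]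
    by (simp add: o_def)
  show "linear (\<lambda>x. - V x)" by (rule linear_compose_neg[OF linear_grad])
  show "V (boundary (V (elem p))) = - V (elem p)" for p
  proof (cases p rule: grad_elem_cases)
    case zero
    then show ?thesis by (simp add: linear_0[OF linear_grad] linear_0[OF linear_boundary])
  next
    case (source q j)
    then show ?thesis
      by (simp only: linear_neg[OF linear_grad] linear_neg[OF linear_boundary] grad_boundary_elem
          linear_scale[OF linear_grad] linear_scale[OF linear_boundary]) simp
  qed
qed

text \<open>The three terms of the flow contribute \<open>V x\<close>, \<open>- V x\<close> and
  0.\<close>

lemma grad_flow: "V (\<Phi> x) = 0"
  by (simp add: flow_def linear_add[OF linear_grad] grad_grad grad_boundary_grad)

text \<open>Both \<open>V\<close> and \<open>V\<close> after \<open>boundary\<close> vanish on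
  \<open>\<Phi> x\<close>, so applying the flow again changes nothing.\<close>

lemma flow_flow: "\<Phi> (\<Phi> x) = \<Phi> x"
proof -
  have "boundary (\<Phi> x) = boundary x + boundary (V (boundary x))"
    by (simp add: flow_def linear_add[OF linear_boundary] boundary_boundary)
  then have "V (boundary (\<Phi> x)) = 0"
    by (simp add: linear_add[OF linear_grad] grad_boundary_grad)
  then show ?thesis
    using flow_def[of H f "\<Phi> x"] by (simp add: grad_flow linear_0[OF linear_boundary])
qed

section \<open>Critical paths and the flow\<close>

lemma critical_iff:
  "critical H f p \<longleftrightarrow> allowed H p \<and> level_cofaces H f p = {} \<and> level_faces H f p = {}"
  \<comment> \<open>\<open>card\<close> is 0 on infinite sets too, so emptiness needs
    finiteness.\<close>
  using finite_level_cofaces[OF finite_pverts] finite_level_faces[OF finite_pverts]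
  by (simp add: critical_def)

text \<open>Values of \<open>V\<close> are combinations of paths that have a level face, none of
  which is critical.\<close>

lemma select_critical_grad: "\<kappa> (V x) = 0"
proof (rule linear_eq_on_elem[of "\<lambda>x. \<kappa> (V x)" "\<lambda>_. 0"])
  show "linear (\<lambda>x. \<kappa> (V x))"
    using linear_compose[OF linear_grad linear_select] by (simp add: o_def)
  show "linear (\<lambda>x :: 'v chain. 0 :: 'v chain)" by (rule linear_zero)
  show "\<kappa> (V (elem p)) = 0" for p
  proof (cases p rule: grad_elem_cases)
    case zero
    then show ?thesis by (simp add: linear_0[OF linear_select])
  next
    case (source q j)
    then have "\<not> critical H f q" using level_face_zero[of q j] by (auto simp: critical_iff)
    then show ?thesis
      unfolding source(6) linear_neg[OF linear_select] linear_scale[OF linear_select]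
      by (simp add: select_elem)
  qed
qed

lemma grad_select_critical: "V (\<kappa> x) = 0"
proof (rule linear_eq_on_elem[of "\<lambda>x. V (\<kappa> x)" "\<lambda>_. 0"])
  show "linear (\<lambda>x. V (\<kappa> x))"
    using linear_compose[OF linear_select linear_grad] by (simp add: o_def)
  show "linear (\<lambda>x :: 'v chain. 0 :: 'v chain)" by (rule linear_zero)
  show "V (\<kappa> (elem p)) = 0" for p
    by (simp add: select_elem critical_iff grad_elem_eq_0 linear_0[OF linear_grad])
qed

text \<open>\<open>V\<close> vanishes on critical paths and the projection kills the values of
  \<open>V\<close>, so only the identity term survives. Hence the flow is injective on critical
  chains.\<close>

lemma select_critical_flow: "\<kappa> (\<Phi> (\<kappa> x)) = \<kappa> x"
  by (simp add: flow_def linear_add[OF linear_select] select_select select_critical_grad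
      grad_select_critical linear_0[OF linear_boundary] linear_0[OF linear_select])

text \<open>With \<open>V x = 0\<close> this says that \<open>\<Phi> x\<close> only depends on the critical part of \<open>x\<close>.\<close>

lemma flow_decomposition:
  assumes "x \<in> span {elem p |p. allowed H p}"
  shows "\<Phi> x = \<Phi> (\<kappa> x) - \<Phi> (\<sigma> (boundary (V x)))"
proof (rule linear_eq_on_span[OF _ _ _ assms])
  show "linear \<Phi>" by (rule linear_flow)
  show "linear (\<lambda>x. \<Phi> (\<kappa> x) - \<Phi> (\<sigma> (boundary (V x))))"
    using linear_compose[OF linear_select linear_flow]
      linear_compose[OF linear_compose[OF linear_compose[OF linear_grad linear_boundary]
          linear_select] linear_flow]
    by (intro linear_compose_sub) (auto simp: o_def)
  fix x assume "x \<in> {elem p |p. allowed H p}"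
  then obtain p where p: "allowed H p" "x = elem p" by blast
  note lin0 = linear_0[OF linear_grad] linear_0[OF linear_boundary] linear_0[OF linear_select]
    linear_0[OF linear_flow]
  show "\<Phi> x = \<Phi> (\<kappa> x) - \<Phi> (\<sigma> (boundary (V x)))"
  proof (cases "critical H f p")
    case True
    then have "V (elem p) = 0" by (simp add: critical_iff grad_elem_eq_0)
    then show ?thesis using True by (simp add: p(2) select_elem lin0)
  next
    case nc: False
    then have k: "\<kappa> x = 0" by (simp add: p(2) select_elem)
    show ?thesis
    \<comment> \<open>A non-critical path belongs to a level pair. If it is the upper member,
      \<open>V (boundary x) = - x\<close> and \<open>V x = 0\<close>, so both sides vanish; if it is
      the lower one, \<open>\<sigma> (boundary (V x)) = - x\<close>, and the second term alone gives
      \<open>\<Phi> x\<close>.\<close>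
    proof (cases "level_cofaces H f p = {}")
      case True
      then obtain p' where p': "p' \<in> level_faces H f p" using nc p(1) by (auto simp: critical_iff)
      then have "p \<in> level_cofaces H f p'" using level_coface_if_level_face p(1) by blast
      then obtain j where j: "j < length p" "f (p ! j) = 0" using level_cofaces_del_nth by blast
      have "2 \<le> length p" using p' by (auto simp: level_faces_def allowed_def Suc_le_eq)
      then have "V (boundary x) = - x" "V x = 0"
        using grad_boundary_elem[OF p(1) _ j] True p(2) grad_elem_eq_0 by auto
      then show ?thesis using k by (simp add: flow_def lin0)
    next
      case False
      then obtain q where q: "q \<in> level_cofaces H f p" by blast
      then obtain j where j: "j < length q" "p = del_nth j q" "f (q ! j) = 0"
        using level_cofaces_del_nth by blast
      have q2: "allowed H q" "2 \<le> length q"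
        using q p by (auto simp: level_cofaces_def allowed_def Suc_le_eq)
      have "\<sigma> (boundary (elem q)) = (\<Sum>i<length q. (-1) ^ i *\<^sub>R \<sigma> (elem (del_nth i q)))"
        using q2(2)
        by (simp add: boundary_elem linear_sum[OF linear_select] linear_scale[OF linear_select])
      also have "\<dots> = (\<Sum>i<length q. if i = j then (-1) ^ j *\<^sub>R elem p else 0)"
        using zero_free_del_nth[OF q2(1) _ j(1,3)] j(2) by (intro sum.cong) (auto simp: select_elem)
      also have "\<dots> = (-1) ^ j *\<^sub>R elem p" using j(1) by simp
      finally have "\<sigma> (boundary (V x)) = - x"
        using grad_del_nth[OF q2 j(1,3)] p(2) j(2)
        by (simp add: linear_neg[OF linear_select] linear_scale[OF linear_select]
            linear_neg[OF linear_boundary] linear_scale[OF linear_boundary])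
      then show ?thesis using k by (simp add: lin0 linear_neg[OF linear_flow])
    qed
  qed
qed

text \<open>A chain \<open>y\<close> in the image of the flow satisfies \<open>V y = 0\<close> and
  \<open>\<Phi> y = y\<close>, so the decomposition collapses to
  \<open>y = \<Phi> (\<kappa> y)\<close>.\<close>

lemma flow_image:
  assumes "contained_in G H" "\<And>x. x \<in> Omega G n \<Longrightarrow> \<Phi> x \<in> Omega G n"
    and "\<And>x. x \<in> Crit H f n \<inter> P G n \<Longrightarrow> \<Phi> x \<in> Omega G n"
    and "\<kappa> ` P G n \<subseteq> Crit H f n \<inter> P G n"
  shows "\<Phi> ` Omega G n = \<Phi> ` (Crit H f n \<inter> P G n)"
proof (intro subset_antisym subsetI)
  fix y assume "y \<in> \<Phi> ` Omega G n"
  then obtain x where x: "x \<in> Omega G n" "y = \<Phi> x" by blast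
  have yP: "y \<in> P G n" using assms(2)[OF x(1)] x(2) by (simp add: Omega_def)
  have "P G n \<subseteq> span {elem p |p. allowed H p}"
    unfolding P_def using allowed_mono[OF assms(1)] by (intro span_mono) blast
  then have "\<Phi> y = \<Phi> (\<kappa> y) - \<Phi> (\<sigma> (boundary (V y)))"
    using yP flow_decomposition by blast
  moreover have "V y = 0" "\<Phi> y = y" by (simp_all add: x(2) grad_flow flow_flow)
  ultimately have "y = \<Phi> (\<kappa> y)"
    by (simp add: linear_0[OF linear_boundary] linear_0[OF linear_select] linear_0[OF linear_flow])
  then show "y \<in> \<Phi> ` (Crit H f n \<inter> P G n)" using assms(4) yP by blast
next
  fix y assume "y \<in> \<Phi> ` (Crit H f n \<inter> P G n)"
  then obtain c where "c \<in> Crit H f n \<inter> P G n" "y = \<Phi> c" by blast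
  \<comment> \<open>The chain \<open>c\<close> may lie outside \<open>Omega G n\<close>; by
    idempotence \<open>y\<close> can replace it as preimage.\<close>
  then have "y \<in> Omega G n" "y = \<Phi> y" using assms(3) by (simp_all add: flow_flow)
  then show "y \<in> \<Phi> ` Omega G n" by (rule rev_image_eqI)
qed

lemma dim_flow_critical:
  assumes "subspace U" "U \<subseteq> Crit H f n" "U \<subseteq> span F" "finite F"
  shows "dim (\<Phi> ` U) = dim U"
proof -
  have "{x \<in> U. \<Phi> x = 0} \<subseteq> {0}"
  proof
    fix x assume x: "x \<in> {x \<in> U. \<Phi> x = 0}"
    then have "\<kappa> x = x" using select_Crit assms(2) by blast
    then have "x = \<kappa> (\<Phi> x)" using select_critical_flow[of x] by simp
    then show "x \<in> {0}" using x by (simp add: linear_0[OF linear_select])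
  qed
  then have "dim {x \<in> U. \<Phi> x = 0} = 0"
    using dim_le_card[of "{x \<in> U. \<Phi> x = 0}" "{}"] by auto
  then show ?thesis
    using dim_kernel_plus_image[OF linear_flow assms(1,3,4), of H f] by simp
qed

end

section \<open>Comparison of the digraph with its closure\<close>

lemma select_P_subset:
  assumes "\<And>p. allowed G p \<Longrightarrow> Q p \<Longrightarrow> length p = n + 1 \<Longrightarrow> elem p \<in> U" "subspace U"
  shows "select Q ` P G n \<subseteq> U"
proof -
  have "select Q ` {elem p |p. allowed G p \<and> length p = n + 1} \<subseteq> U"
    using assms(1) subspace_0[OF assms(2)] by (auto simp: select_elem)
  then show ?thesis
    unfolding P_def linear_span_image[OF linear_select, symmetric] by (rule span_minimal) (rule assms(2))
qed

text \<open>A level pair of \<open>G\<close> is also one of \<open>H\<close>, so passing to the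
  subgraph can only create critical paths. This is the source of the first inequality.\<close>

lemma critical_subgraph:
  assumes "contained_in G H" "finite (pverts H)" "\<forall>v\<in>pverts G. fbar v = f v"
    and "allowed G p" "critical H fbar p"
  shows "critical G f p"
proof -
  have pv: "path_value fbar q = path_value f q" if "allowed G q" for q
    using that assms(3) unfolding path_value_def allowed_def
    by (intro arg_cong[of _ _ sum_list] map_cong) auto
  have "level_cofaces G f p \<subseteq> level_cofaces H fbar p" "level_faces G f p \<subseteq> level_faces H fbar p"
    using allowed_mono[OF assms(1)] pv assms(4) by (auto simp: level_cofaces_def level_faces_def)
  moreover have "level_cofaces H fbar p = {}" "level_faces H fbar p = {}"
    using assms(5) finite_level_cofaces[OF assms(2)] finite_level_faces[OF assms(2)]
    by (simp_all add: critical_def)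
  ultimately show ?thesis using assms(4) by (simp add: critical_def)
qed

lemma subspace_P: "subspace (P G n)"
  by (simp add: P_def)

lemma boundary_P_0: "x \<in> P G 0 \<Longrightarrow> boundary x = 0"
  unfolding P_def
  by (rule linear_eq_on_span[OF linear_boundary linear_zero,
        where B = "{elem p |p. allowed G p \<and> length p = 0 + 1}"])
    (auto simp: boundary_elem)

lemma subspace_Omega: "subspace (Omega G n)"
  using subspace_P[of G n] subspace_P[of G "n - 1"]
  by (auto simp: Omega_def subspace_def linear_0[OF linear_boundary] linear_add[OF linear_boundary]
      linear_scale[OF linear_boundary])

lemma boundary_Omega: "x \<in> Omega G (Suc n) \<Longrightarrow> boundary x \<in> Omega G n"
  using subspace_0[OF subspace_P[of G "n - 1"]] by (simp add: Omega_def boundary_boundary)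

theorem theorem5p1:
  fixes G H :: "'v pair_pre_digraph"
    and f fbar :: "'v \<Rightarrow> real"
  assumes "is_digraph G"
    and "is_transitive_closure H G"
    and "discrete_morse G f"
    and "discrete_morse H fbar"
    and "\<forall>v \<in> pverts G. fbar v = f v"
    and "\<forall>n. grad H fbar ` Omega G n \<subseteq> Omega G (n + 1)"
    and "\<forall>n. \<forall>\<alpha> \<in> Crit H fbar n \<inter> P G n. flow H fbar \<alpha> \<in> Omega G n"
  shows "(\<forall>m.
           dim (Crit G f m) \<ge> dim (Crit H fbar m \<inter> P G m) \<and>
           (\<Sum>i\<le>m. (-1) ^ (m - i) * int (dim (Crit H fbar i \<inter> P G i)))
             \<ge> (\<Sum>i\<le>m. (-1) ^ (m - i) * int (betti G i))) \<and>
         (\<Sum>i\<le>digraph_dim G. (-1) ^ i * int (dim (Crit H fbar i \<inter> P G i)))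
           \<ge> (\<Sum>i\<le>digraph_dim G. (-1) ^ i * int (betti G i))"
proof -
  have cont: "contained_in G H" and trans: "transitive_digraph H"
    using assms(2) by (auto simp: is_transitive_closure_def)
  interpret transitive_morse H fbar using trans assms(4) by unfold_locales
  have finG: "finite (pverts G)"
    using cont finite_pverts finite_subset by (auto simp: contained_in_def)
  let ?F = "\<lambda>n. {elem p |p. allowed G p \<and> length p = n + 1} :: 'v chain set"
  let ?X = "\<lambda>n. Crit H fbar n \<inter> P G n"
  have finF: "finite (?F n)" for n
    using finite_imageI[OF finite_paths[OF finG, of "n + 1"], of elem] by (simp add: setcompr_eq_image)
  have PF: "P G n \<subseteq> span (?F n)" for n by (simp add: P_def)
  have OP: "Omega G n \<subseteq> P G n" for n by (auto simp: Omega_def)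
  have VO: "V x \<in> Omega G (Suc n)" if "x \<in> Omega G n" for x n using assms(6) that by auto
  have VbO: "V (boundary x) \<in> Omega G n" if "x \<in> Omega G n" for x n
  proof (cases n)
    case 0
    then have "boundary x = 0" using that OP boundary_P_0 by blast
    then show ?thesis using subspace_0[OF subspace_Omega] by (simp add: linear_0[OF linear_grad])
  next
    case (Suc k)
    then show ?thesis using that boundary_Omega VO by blast
  qed
  have flowO: "\<Phi> x \<in> Omega G n" if "x \<in> Omega G n" for x n
    unfolding flow_def using that VbO boundary_Omega[OF VO[OF that]]
    by (intro subspace_add[OF subspace_Omega])
  have subX: "subspace (?X n)" for n
    using subspace_P by (intro subspace_inter) (simp_all add: Crit_def)
  have \<kappa>X: "\<kappa> ` P G n \<subseteq> ?X n" for n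
    by (rule select_P_subset[OF _ subX]) (auto simp: Crit_def P_def intro!: span_base)
  \<comment> \<open>The flow sends \<open>?X n\<close> onto the image of \<open>Omega G n\<close>,
    and injectively, so the ranks in the algebraic inequalities are the numbers l_n.\<close>
  have dimX: "dim (\<Phi> ` Omega G n) = dim (?X n)" for n
  proof -
    have "\<Phi> ` Omega G n = \<Phi> ` ?X n"
      using flow_image[OF cont flowO _ \<kappa>X] assms(7) by blast
    also have "dim \<dots> = dim (?X n)"
      using PF by (intro dim_flow_critical[OF subX _ _ finF]) auto
    finally show ?thesis .
  qed
  have key: "(\<Sum>i\<le>m. (-1) ^ (m - i) * int (dim (?X i))) =
      (\<Sum>i\<le>m. (-1) ^ (m - i) * int (betti G i))
        + int (dim (boundary ` \<Phi> ` Omega G (Suc m)))" for m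
  proof -
    have "(\<Sum>i\<le>m. (-1) ^ (m - i) * int (dim (\<Phi> ` Omega G i))) =
        (\<Sum>i\<le>m. (-1) ^ (m - i) * int (quot_dim {x \<in> Omega G i. boundary x = 0}
          (boundary ` Omega G (i + 1)))) + int (dim (boundary ` \<Phi> ` Omega G (Suc m)))"
    proof (rule morse_of_idempotent_chain_homotopy[where F = ?F and V = V])
      show "boundary x = 0" if "x \<in> Omega G 0" for x using that OP boundary_P_0 by blast
      show "Omega G n \<subseteq> span (?F n)" for n using OP PF by blast
    qed (use finF VO in \<open>simp_all add: flow_def[symmetric] flow_flow linear_boundary linear_grad
          subspace_Omega boundary_Omega boundary_boundary\<close>)
    then show ?thesis by (simp add: dimX betti_def)
  qed
  \<comment> \<open>Each chain in \<open>?X m\<close> is its own critical projection, hence a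
    combination of paths both allowed in \<open>G\<close> and critical in \<open>H\<close>.\<close>
  have L: "dim (?X m) \<le> dim (Crit G f m)" for m
  proof (rule dim_mono_finite[OF _ _ finF])
    have "elem p \<in> Crit G f m" if "allowed G p" "critical H fbar p" "length p = m + 1" for p
      using critical_subgraph[OF cont finite_pverts assms(5) that(1,2)] that(3)
      by (auto simp: Crit_def intro!: span_base)
    then have "\<kappa> ` P G m \<subseteq> Crit G f m"
      by (rule select_P_subset) (simp_all add: Crit_def)
    moreover have "x \<in> \<kappa> ` P G m" if "x \<in> ?X m" for x
      using that select_Crit[of x H fbar m] by (intro image_eqI[of _ _ x]) auto
    ultimately show "?X m \<subseteq> Crit G f m" by blast
    show "Crit G f m \<subseteq> span (?F m)"
      unfolding Crit_def by (intro span_mono) (auto simp: critical_def)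
  qed
  let ?D = "digraph_dim G"
  have "Omega G (Suc ?D) = {0}"
  proof (rule ccontr)
    assume ne: "Omega G (Suc ?D) \<noteq> {0}"
    let ?S = "{p. Omega G p \<noteq> {0}}"
    \<comment> \<open>\<open>digraph_dim\<close> is a \<open>Max\<close>, which bounds the members
      of a finite set only. Allowed paths of \<open>G\<close> are allowed in \<open>H\<close> and so
      have distinct vertices, which bounds their length.\<close>
    have "?S \<subseteq> {..card (pverts G)}"
    proof
      fix n assume "n \<in> ?S"
      then have "Omega G n \<noteq> {0}" by simp
      then have "\<not> Omega G n \<subseteq> span {}" using subspace_0[OF subspace_Omega, of G n] by auto
      then have "\<not> span (?F n) \<subseteq> span {}" using OP[of n] PF[of n] by (meson subset_trans)
      then have "?F n \<noteq> {}"
      proof (rule contrapos_nn)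
        assume "?F n = {}"
        then show "span (?F n) \<subseteq> span {}" by (simp only: subset_refl)
      qed
      then obtain p where p: "allowed G p" "length p = n + 1" by blast
      have "card (set p) = n + 1"
        using distinct_allowed[OF allowed_mono[OF cont p(1)]] p(2) by (simp add: distinct_card)
      moreover have "card (set p) \<le> card (pverts G)"
        using p(1) finG by (intro card_mono) (auto simp: allowed_def)
      ultimately show "n \<in> {..card (pverts G)}" by simp
    qed
    then have "finite ?S" by (rule finite_subset) simp
    then have "Suc ?D \<le> ?D" unfolding digraph_dim_def using ne
      by (intro Max_ge) (simp_all add: digraph_dim_def)
    then show False by simp
  qed
  then have "boundary ` \<Phi> ` Omega G (Suc ?D) \<subseteq> {0}"
    by (simp add: linear_0[OF linear_flow] linear_0[OF linear_boundary])
  then have r0: "dim (boundary ` \<Phi> ` Omega G (Suc ?D)) = 0"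
    using dim_le_card[of "boundary ` \<Phi> ` Omega G (Suc ?D)" "{}"] by auto
  \<comment> \<open>The factor relating the two sign conventions may be negative and reverse an
    inequality; in degree \<open>?D\<close> the remainder is zero by \<open>r0\<close>, so an
    equality is multiplied.\<close>
  have sgn: "(\<Sum>i\<le>m. (-1) ^ i * g i) = (-1) ^ m * (\<Sum>i\<le>m. (-1) ^ (m - i) * g i)"
    for m and g :: "nat \<Rightarrow> int"
  proof -
    have "(-1) ^ m * (-1::int) ^ (m - i) = (-1) ^ i" if "i \<le> m" for i
      using that by (cases "even i"; cases "even m") auto
    then show ?thesis
      unfolding sum_distrib_left mult.assoc[symmetric] by (intro sum.cong) simp_all
  qed
  show ?thesis
    unfolding sgn[where m = ?D] using L key r0 by simp
qed

end
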